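(* Let $\boldsymbol{\sigma}=(\sigma_n)_{n\ge0}$ be an everywhere growing sequence of morphisms $\sigma_n:\mathcal{A}_{n+1}\to\mathcal{A}_n^+$ such that $\liminf_{n\to\infty}|\mathcal{A}_n|<\infty$. Then $\boldsymbol{\sigma}$ is eventually recognizable for aperiodic points, i.e., there is $n_0\in\mathbb{N}$ such that for every $n\ge n_0$, every aperiodic $y\in\mathcal{A}_n^{\mathbb{Z}}$ has at most one centered $\sigma_n$-representation in $X_{\boldsymbol{\sigma}}^{(n+1)}$.
   Context: Alphabets are finite. A morphism $\sigma:\mathcal{A}\to\mathcal{B}^+$ is given by a non-empty word $\sigma(a)$ for each letter $a$ and is extended by concatenation to $\mathcal{A}^*$ and $\mathcal{A}^{\mathbb{Z}}$ (with $\sigma(x_0)$ starting at index $0$ in $\sigma(x)$). $T$ is the left shift. A point $y$ is periodic if $T^k(y)=y$ for some $k\ge1$, aperiodic otherwise. A $\sigma$-representation of $y\in\mathcal{B}^{\mathbb{Z}}$ is a pair $(k,x)$ with $k\in\mathbb{Z}$, $x\in\mathcal{A}^{\mathbb{Z}}$, $y=T^k\sigma(x)$; it is centered if $0\le k<|\sigma(x_0)|$, and it is in $X\subseteq\mathcal{A}^{\mathbb{Z}}$ if $x\in X$. For $0\le n<N$, $\sigma_{[n,N)}=\sigma_n\circ\cdots\circ\sigma_{N-1}$. The sequence $\boldsymbol{\sigma}$ is everywhere growing if $\lim_{n\to\infty}\min_{a\in\mathcal{A}_n}|\sigma_{[0,n)}(a)|=\infty$. The language $\mathcal{L}_{\boldsymbol{\sigma}}^{(n)}$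 is the set of all $w\in\mathcal{A}_n^*$ that are subwords (factors) of $\sigma_{[n,N)}(a)$ for some $N>n$ and $a\in\mathcal{A}_N$; $X_{\boldsymbol{\sigma}}^{(n)}$ is the set of $x\in\mathcal{A}_n^{\mathbb{Z}}$ all of whose finite subwords belong to $\mathcal{L}_{\boldsymbol{\sigma}}^{(n)}$. *)

theory Defs
  imports "HOL-Library.Extended_Real" "HOL-Library.Sublist"
begin

definition morphism :: "'a set \<Rightarrow> 'b set \<Rightarrow> ('a \<Rightarrow> 'b list) \<Rightarrow> bool" where
  "morphism A B s \<longleftrightarrow> (\<forall>a\<in>A. s a \<noteq> [] \<and> s a \<in> lists B)"

definition ext_word :: "('a \<Rightarrow> 'b list) \<Rightarrow> 'a list \<Rightarrow> 'b list" where
  "ext_word s w = concat (map s w)"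

text \<open>
  In the image of a bi-infinite sequence \<open>x\<close>, the word \<open>s(x\<^sub>0) s(x\<^sub>1) \<dots> s(x\<^sub>m)\<close> occupies the
  positions from 0 on, and \<open>s(x\<^sub>m) \<dots> s(x\<^sub>-\<^sub>2) s(x\<^sub>-\<^sub>1)\<close> ends at position \<open>-1\<close>. Since the images of
  letters are non-empty, these words are long enough to reach position \<open>m\<close>; the lemmas
  \<open>ext_seq_nonneg\<close> and \<open>ext_seq_neg\<close> below locate all the blocks.
\<close>
definition ext_seq :: "('a \<Rightarrow> 'b list) \<Rightarrow> (int \<Rightarrow> 'a) \<Rightarrow> int \<Rightarrow> 'b" where
  "ext_seq s x m =
     (if 0 \<le> m then ext_word s (map x [0..m]) ! nat m
      else let w = ext_word s (map x [m..-1]) in w ! nat (int (length w) + m))"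

definition shift :: "int \<Rightarrow> (int \<Rightarrow> 'a) \<Rightarrow> int \<Rightarrow> 'a" where
  "shift k y = (\<lambda>i. y (i + k))"

definition periodic :: "(int \<Rightarrow> 'a) \<Rightarrow> bool" where
  "periodic y \<longleftrightarrow> (\<exists>k\<ge>1. shift k y = y)"

abbreviation aperiodic :: "(int \<Rightarrow> 'a) \<Rightarrow> bool" where
  "aperiodic y \<equiv> \<not> periodic y"

definition full_shift :: "'a set \<Rightarrow> (int \<Rightarrow> 'a) set" where
  "full_shift A = {x. range x \<subseteq> A}"

definition representation ::
    "'a set \<Rightarrow> ('a \<Rightarrow> 'b list) \<Rightarrow> (int \<Rightarrow> 'b) \<Rightarrow> int \<times> (int \<Rightarrow> 'a) \<Rightarrow> bool" where
  "representation A s y = (\<lambda>(k, x). x \<in> full_shift A \<and> y = shift k (ext_seq s x))"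

definition centered :: "('a \<Rightarrow> 'b list) \<Rightarrow> int \<times> (int \<Rightarrow> 'a) \<Rightarrow> bool" where
  "centered s = (\<lambda>(k, x). 0 \<le> k \<and> k < int (length (s (x 0))))"

text \<open>\<open>comp_range \<sigma> n N\<close> is \<open>\<sigma>\<^sub>n \<circ> \<dots> \<circ> \<sigma>\<^sub>N\<^sub>-\<^sub>1\<close> as a map on words.\<close>
definition comp_range :: "(nat \<Rightarrow> 'a \<Rightarrow> 'a list) \<Rightarrow> nat \<Rightarrow> nat \<Rightarrow> 'a list \<Rightarrow> 'a list" where
  "comp_range \<sigma> n N = foldr (\<circ>) (map (\<lambda>m. ext_word (\<sigma> m)) [n..<N]) id"

text \<open>
  The infimum in \<^typ>\<open>enat\<close> is the minimum for a non-empty finite alphabet, and \<open>\<infinity>\<close> for an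
  empty one.
\<close>
definition everywhere_growing :: "(nat \<Rightarrow> 'a set) \<Rightarrow> (nat \<Rightarrow> 'a \<Rightarrow> 'a list) \<Rightarrow> bool" where
  "everywhere_growing A \<sigma> \<longleftrightarrow>
     (\<lambda>n. INF a\<in>A n. enat (length (comp_range \<sigma> 0 n [a]))) \<longlonglongrightarrow> \<infinity>"

definition language :: "(nat \<Rightarrow> 'a set) \<Rightarrow> (nat \<Rightarrow> 'a \<Rightarrow> 'a list) \<Rightarrow> nat \<Rightarrow> 'a list set" where
  "language A \<sigma> n = {w \<in> lists (A n). \<exists>N>n. \<exists>a\<in>A N. sublist w (comp_range \<sigma> n N [a])}"

definition sadic_shift :: "(nat \<Rightarrow> 'a set) \<Rightarrow> (nat \<Rightarrow> 'a \<Rightarrow> 'a list) \<Rightarrow> nat \<Rightarrow> (int \<Rightarrow> 'a) set" where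
  "sadic_shift A \<sigma> n = {x \<in> full_shift (A n). \<forall>i j. map x [i..j] \<in> language A \<sigma> n}"

definition recognizable_for_aperiodic ::
    "'a set \<Rightarrow> 'b set \<Rightarrow> ('a \<Rightarrow> 'b list) \<Rightarrow> (int \<Rightarrow> 'a) set \<Rightarrow> bool" where
  "recognizable_for_aperiodic A B s X \<longleftrightarrow>
     (\<forall>y\<in>full_shift B. aperiodic y \<longrightarrow>
        (\<exists>\<^sub>\<le>\<^sub>1 r. representation A s y r \<and> centered s r \<and> snd r \<in> X))"

lemma length_ext_word_ge:
  assumes "\<And>a. a \<in> set w \<Longrightarrow> s a \<noteq> []"
  shows "length w \<le> length (ext_word s w)"
  using assms
proof (induction w)
  case (Cons a w)
  have "1 \<le> length (s a)"
    using Cons.prems[of a] by (simp add: Suc_le_eq)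
  with Cons show ?case by (simp add: ext_word_def)
qed (simp add: ext_word_def)

lemma ext_seq_nonneg:
  assumes ne: "\<And>i. s (x i) \<noteq> []" and j: "0 \<le> j" and p: "p < length (s (x j))"
  shows "ext_seq s x (int (length (ext_word s (map x [0..j-1])) + p)) = s (x j) ! p"
proof -
  define u where "u = ext_word s (map x [0..j-1])"
  define m where "m = int (length u + p)"
  have "length (map x [0..j-1]) \<le> length u"
    unfolding u_def by (rule length_ext_word_ge) (use ne in auto)
  then have "j \<le> m" using j by (simp add: m_def)
  then have "[0..m] = [0..j-1] @ j # [j+1..m]" by (rule upto_split3[OF j])
  then have "ext_word s (map x [0..m]) = u @ s (x j) @ ext_word s (map x [j+1..m])"
    by (simp add: u_def ext_word_def)
  moreover have "nat m = length u + p" by (simp only: m_def nat_int)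
  ultimately have "ext_word s (map x [0..m]) ! nat m = s (x j) ! p"
    using p by (simp add: nth_append)
  then show ?thesis
    unfolding u_def[symmetric] m_def[symmetric] by (simp add: ext_seq_def m_def)
qed

lemma ext_seq_neg:
  assumes ne: "\<And>i. s (x i) \<noteq> []" and j: "j < 0" and p: "p < length (s (x j))"
  shows "ext_seq s x (int p - int (length (ext_word s (map x [j..-1])))) = s (x j) ! p"
proof -
  define v where "v = ext_word s (map x [j+1..-1])"
  have split_j: "ext_word s (map x [j..-1]) = s (x j) @ v"
    using j by (simp add: v_def ext_word_def upto_rec1[of j "-1"])
  define m where "m = int p - int (length (s (x j) @ v))"
  have len_v: "length (map x [j+1..-1]) \<le> length v"
    unfolding v_def by (rule length_ext_word_ge) (use ne in auto)
  have "m < 0" using p by (simp add: m_def)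
  have "m \<le> j" using p j len_v by (simp add: m_def)
  then have "[m..-1] = [m..j-1] @ j # [j+1..-1]"
    using j by (intro upto_split3) auto
  then have w: "ext_word s (map x [m..-1]) = ext_word s (map x [m..j-1]) @ s (x j) @ v"
    by (simp add: v_def ext_word_def)
  have "nat (int (length (ext_word s (map x [m..-1]))) + m)
          = length (ext_word s (map x [m..j-1])) + p"
    unfolding w by (simp add: m_def)
  then have "ext_seq s x m = s (x j) ! p"
    using \<open>m < 0\<close> p by (simp add: ext_seq_def Let_def w nth_append)
  then show ?thesis by (simp add: split_j m_def)
qed

end

theory Submission
  imports Defs "HOL-Library.FuncSet" "HOL-Library.Omega_Words_Fun"
begin

text \<open>
  Let the rank of level \<open>n\<close> be the least size of a set \<open>F\<close> of non-empty words over \<open>\<A>\<^sub>n\<close> such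
  that for some \<open>N > n\<close> every \<open>\<sigma>\<^bsub>[n,N)\<^esub>(a)\<close> is a product of words of \<open>F\<close>. It is bounded by
  \<open>lim inf |\<A>\<^sub>n|\<close> and non-decreasing in \<open>n\<close>, hence eventually constant. Once it is constant, a
  minimal \<open>F\<close> for level \<open>n + 1\<close> makes \<open>\<sigma>\<^sub>n\<close> elementary on \<open>F\<close>: the words \<open>\<sigma>\<^sub>n(f)\<close> are not
  products of fewer than \<open>|F|\<close> words. By compactness every point of \<open>X\<^bsup>(n+1)\<^esup>\<close> is a bi-infinite
  product of words of \<open>F\<close>, so it suffices that an aperiodic \<open>y\<close> has at most one factorization into
  blocks of an elementary morphism.

  Two different factorizations have no common cut far to the left, by the defect theorem. So the
  cuts of one lie inside blocks of the other, and by pigeonhole infinitely many of them, going to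
  the left, lie at the same place of the same block. If the continuations to the right of two such
  cuts ever differed, there would be a proper suffix \<open>s\<close> of a block and two infinite products
  of blocks starting with \<open>s\<close> and with different blocks; the defect theorem applied to the blocks
  together with \<open>s\<close> would then lower the rank by one. Hence the continuations agree, and \<open>y\<close> is
  periodic.
\<close>

section \<open>A defect theorem for infinite words\<close>

abbreviation star :: "'a list set \<Rightarrow> 'a list set" where
  "star F \<equiv> concat ` lists F"

text \<open>These are the right-infinite products of words of \<open>X\<close>, provided that
  \<open>[] \<notin> X\<close>: an empty factor could be repeated forever, and every infinite word
  would qualify.\<close>

coinductive omega_power :: "'a list set \<Rightarrow> (nat \<Rightarrow> 'a) \<Rightarrow> bool" for X where
  "u \<in> X \<Longrightarrow> omega_power X y \<Longrightarrow> omega_power X (u \<frown> y)"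

lemma conc_cancel_left: "u \<frown> y = u \<frown> z \<Longrightarrow> y = z"
proof
  fix n assume "u \<frown> y = u \<frown> z"
  then have "(u \<frown> y) (length u + n) = (u \<frown> z) (length u + n)" by simp
  then show "y n = z n" by simp
qed

lemma conc_eq_prefixE:
  assumes "u \<frown> y = v \<frown> z" "length u \<le> length v"
  obtains w where "v = u @ w"
proof -
  have "u = take (length u) v"
  proof (rule nth_equalityI)
    fix i assume "i < length u"
    moreover have "(u \<frown> y) i = (v \<frown> z) i" using assms by simp
    ultimately show "u ! i = take (length u) v ! i" using assms(2) by (simp add: conc_def)
  qed (use assms in auto)
  then show thesis using that by (metis append_take_drop_id)
qed

lemma star_mono_trans:
  assumes "X \<subseteq> star Y" "Y \<subseteq> star Z"
  shows "X \<subseteq> star Z"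
proof
  have *: "concat ws \<in> star Z" if "ws \<in> lists Y" for ws
    using that
  proof (induction ws)
    case (Cons w ws)
    then obtain us vs where "us \<in> lists Z" "w = concat us" "vs \<in> lists Z" "concat ws = concat vs"
      using assms(2) by blast
    then show ?case by (intro image_eqI[of _ _ "us @ vs"]) auto
  qed (auto intro: image_eqI[of _ _ "[]"])
  fix x assume "x \<in> X"
  then show "x \<in> star Z" using assms(1) * by blast
qed

text \<open>The list \<open>ws\<close> is a buffer for the coinduction: its words are emitted one by
  one, and once it is empty the next factor from \<open>X\<close> is expanded over \<open>Y\<close>.
  Since \<open>[] \<notin> X\<close>, that expansion is a non-empty list and supplies a word to
  emit.\<close>

lemma omega_power_conc_star:
  assumes "X \<subseteq> star Y" "[] \<notin> X" "omega_power X y" "ws \<in> lists Y"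
  shows "omega_power Y (concat ws \<frown> y)"
proof -
  have "\<exists>ws y'. z = concat ws \<frown> y' \<and> ws \<in> lists Y \<and> omega_power X y' \<Longrightarrow> omega_power Y z" for z
  proof (coinduction arbitrary: z rule: omega_power.coinduct)
    case (omega_power z)
    then obtain ws y where z: "z = concat ws \<frown> y" "ws \<in> lists Y" "omega_power X y" by blast
    show ?case
    proof (cases ws)
      case (Cons u us)
      then have "z = u \<frown> (concat us \<frown> y)" "u \<in> Y" "us \<in> lists Y" using z by (auto simp: conc_conc)
      then show ?thesis using z(3) by blast
    next
      case Nil
      from z(3) obtain x y' where x: "x \<in> X" "omega_power X y'" "y = x \<frown> y'"
        by (cases rule: omega_power.cases) auto
      then obtain vs where vs: "vs \<in> lists Y" "x = concat vs" using assms(1) by blast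
      then obtain u us where us: "vs = u # us" using x(1) assms(2) by (cases vs) auto
      then have "z = u \<frown> (concat us \<frown> y')" "u \<in> Y" "us \<in> lists Y"
        using z(1) Nil x(3) vs by (auto simp: conc_conc)
      then show ?thesis using x(2) by blast
    qed
  qed
  then show ?thesis using assms(3,4) by blast
qed

lemma omega_power_subset_star:
  assumes "X \<subseteq> star Y" "[] \<notin> X" "omega_power X y"
  shows "omega_power Y y"
  using omega_power_conc_star[OF assms, of "[]"] by simp

lemma subset_star: "X \<subseteq> Y \<Longrightarrow> X \<subseteq> star Y"
proof
  fix x assume "X \<subseteq> Y" "x \<in> X"
  then show "x \<in> star Y" by (intro image_eqI[of _ _ "[x]"]) auto
qed

text \<open>Adjacent words begin two factorizations of one infinite word. The defect theorem bounds
  the size of a generating set by the size of any \<open>S \<subseteq> X\<close> that meets every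
  connected component of this graph.\<close>

definition overlap_graph :: "'a list set \<Rightarrow> ('a list \<times> 'a list) set" where
  "overlap_graph X = {(p, q). p \<in> X \<and> q \<in> X \<and>
     (\<exists>y z. omega_power X y \<and> omega_power X z \<and> p \<frown> y = q \<frown> z)}"

lemma overlap_graph_sym: "(p, q) \<in> overlap_graph X \<Longrightarrow> (q, p) \<in> overlap_graph X"
  unfolding overlap_graph_def by fastforce

text \<open>
  If \<open>x\<close> and \<open>y = x v\<close> are adjacent, replacing \<open>y\<close> by \<open>v\<close> shortens the set of words without
  increasing the number of components: the neighbours of \<open>y\<close> become neighbours of \<open>x\<close>, and cancelling
  \<open>x\<close> in the relation between \<open>x\<close> and \<open>y\<close> links \<open>v\<close> to another word.
\<close>

lemma defect_theorem:
  assumes "finite X" "[] \<notin> X" "S \<subseteq> X"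
    and "\<And>p. p \<in> X \<Longrightarrow> \<exists>s\<in>S. (p, s) \<in> (overlap_graph X)\<^sup>*"
  shows "\<exists>F. finite F \<and> [] \<notin> F \<and> card F \<le> card S \<and> X \<subseteq> star F"
  using assms
proof (induction "\<Sum>x\<in>X. length x" arbitrary: X S rule: less_induct)
  case less
  note fin = less.prems(1) and ne = less.prems(2) and SX = less.prems(3) and con = less.prems(4)
  show ?case
  proof (cases "overlap_graph X \<subseteq> Id")
    \<comment> \<open>Without edges between distinct words each component is a single word, so
      \<open>S\<close> is all of \<open>X\<close>, and \<open>X\<close> itself serves as
      \<open>F\<close>.\<close>
    case True
    then have "(overlap_graph X)\<^sup>* \<subseteq> Id" using rtrancl_subset_rtrancl[of _ "{}"] by auto
    then have "X \<subseteq> S" using con by blast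
    then show ?thesis using fin ne SX subset_star by (metis order.refl subset_antisym)
  next
    case False
    then obtain a b where "(a, b) \<in> overlap_graph X" "a \<noteq> b" by auto
    then obtain x y where xy: "(x, y) \<in> overlap_graph X" "x \<noteq> y" "length x \<le> length y"
      using overlap_graph_sym by (metis nle_le)
    then obtain z z' where z: "omega_power X z" "omega_power X z'" "x \<frown> z = y \<frown> z'"
      and X: "x \<in> X" "y \<in> X"
      unfolding overlap_graph_def by auto
    obtain v where v: "y = x @ v" using conc_eq_prefixE[OF z(3) xy(3)] by blast
    have "v \<noteq> []" "x \<noteq> []" using v xy(2) X(1) ne by auto
    have zv: "z = v \<frown> z'" using z(3) v conc_cancel_left by (metis conc_conc)
    define X' where "X' = insert v (X - {y})"
    \<comment> \<open>A factorization over \<open>X\<close> that starts with \<open>p\<close> can be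
      rewritten over \<open>X'\<close> so that it starts with \<open>r p\<close>, because
      \<open>y\<close> becomes \<open>x\<close> followed by \<open>v\<close>.\<close>
    define r where "r p = (if p = y then x else p)" for p
    have XX': "X \<subseteq> star X'"
    proof
      fix p assume "p \<in> X"
      then show "p \<in> star X'"
        using v xy(2) X by (cases "p = y")
          (auto simp: X'_def intro!: image_eqI[of _ concat "[x, v]"] image_eqI[of p concat "[p]"])
    qed
    have r: "r p \<in> X - {y}" if "p \<in> X" for p using that xy(2) X by (auto simp: r_def)
    have first: "\<exists>w'. omega_power X' w' \<and> p \<frown> w = r p \<frown> w'"
      if "p \<in> X" "omega_power X w" for p w
    proof (cases "p = y")
      case True
      have "omega_power X' (v \<frown> w)"
        using omega_power_conc_star[OF XX' ne that(2), of "[v]"] by (simp add: X'_def)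
      then show ?thesis using True v by (auto simp: r_def conc_conc)
    next
      case False
      then show ?thesis using omega_power_subset_star[OF XX' ne that(2)] by (auto simp: r_def)
    qed
    have edge: "(r p, r q) \<in> overlap_graph X'" if pq: "(p, q) \<in> overlap_graph X" for p q
    proof -
      obtain w w' where w: "p \<in> X" "q \<in> X" "omega_power X w" "omega_power X w'" "p \<frown> w = q \<frown> w'"
        using pq unfolding overlap_graph_def by auto
      then obtain u u' where "omega_power X' u" "omega_power X' u'" "r p \<frown> u = r q \<frown> u'"
        using first by metis
      moreover have "r p \<in> X'" "r q \<in> X'" using r w by (auto simp: X'_def)
      ultimately show ?thesis unfolding overlap_graph_def by auto
    qed
    have path: "(r p, r q) \<in> (overlap_graph X')\<^sup>*" if "(p, q) \<in> (overlap_graph X)\<^sup>*" for p q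
      using that by induction (auto intro: edge rtrancl_into_rtrancl)
    have conr: "\<exists>s\<in>r ` S. (r p, s) \<in> (overlap_graph X')\<^sup>*" if "p \<in> X" for p
      using con[OF that] path by blast
    have con': "\<exists>s\<in>r ` S. (p, s) \<in> (overlap_graph X')\<^sup>*" if "p \<in> X'" for p
    proof (cases "p \<in> X - {y}")
      case True
      then show ?thesis using conr[of p] by (simp add: r_def)
    next
      case False
      then have "p = v" using that by (auto simp: X'_def)
      from z(1) obtain q w where q: "q \<in> X" "omega_power X w" "z = q \<frown> w"
        by (cases rule: omega_power.cases) auto
      obtain w' where "omega_power X' w'" "v \<frown> z' = r q \<frown> w'" using first[OF q(1,2)] q(3) zv by auto
      moreover have "omega_power X' z'" using omega_power_subset_star[OF XX' ne z(2)] .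
      ultimately have "(v, r q) \<in> overlap_graph X'"
        using r[OF q(1)] unfolding overlap_graph_def by (auto simp: X'_def)
      then show ?thesis using conr[OF q(1)] \<open>p = v\<close> by (meson converse_rtrancl_into_rtrancl)
    qed
    \<comment> \<open>Only an inequality, as \<open>v\<close> may already lie in
      \<open>X - {y}\<close>. The total length still drops because \<open>y\<close> is longer than
      \<open>v\<close> by the non-empty word \<open>x\<close>.\<close>
    have "(\<Sum>x\<in>X'. length x) \<le> length v + (\<Sum>x\<in>X - {y}. length x)"
      using fin by (cases "v \<in> X - {y}") (auto simp: X'_def insert_absorb)
    also have "\<dots> < length y + (\<Sum>x\<in>X - {y}. length x)" using v \<open>x \<noteq> []\<close> by simp
    also have "\<dots> = (\<Sum>x\<in>X. length x)" using fin X by (simp add: sum.remove[of X y])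
    finally have "(\<Sum>x\<in>X'. length x) < (\<Sum>x\<in>X. length x)" .
    moreover have "r ` S \<subseteq> X'" using r SX by (auto simp: X'_def)
    moreover have "finite X'" "[] \<notin> X'" using fin ne \<open>v \<noteq> []\<close> by (auto simp: X'_def)
    ultimately obtain F where "finite F" "[] \<notin> F" "card F \<le> card (r ` S)" "X' \<subseteq> star F"
      using less.hyps con' by metis
    moreover have "card (r ` S) \<le> card S" using fin SX finite_subset card_image_le by blast
    ultimately show ?thesis using star_mono_trans[OF XX'] by (metis order.trans)
  qed
qed

section \<open>Elementary morphisms\<close>

text \<open>Elementary in the sense of Ehrenfeucht and Rozenberg: the morphism does not factor
  through a smaller alphabet, the words of \<open>F\<close> being the images of the letters of such
  an intermediate alphabet.\<close>

definition elementary :: "'c set \<Rightarrow> ('c \<Rightarrow> 'b list) \<Rightarrow> bool" where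
  "elementary C \<tau> \<longleftrightarrow> finite C \<and> (\<forall>c\<in>C. \<tau> c \<noteq> []) \<and>
     (\<forall>F. finite F \<longrightarrow> [] \<notin> F \<longrightarrow> \<tau> ` C \<subseteq> star F \<longrightarrow> card C \<le> card F)"

lemma elementary_card_le:
  "elementary C \<tau> \<Longrightarrow> finite F \<Longrightarrow> [] \<notin> F \<Longrightarrow> \<tau> ` C \<subseteq> star F \<Longrightarrow> card C \<le> card F"
  unfolding elementary_def by blast

text \<open>The images themselves generate all images, and they would be too few if two of them
  coincided.\<close>

lemma elementary_inj_on:
  assumes "elementary C \<tau>"
  shows "inj_on \<tau> C"
proof -
  have "finite C" "[] \<notin> \<tau> ` C" using assms by (auto simp: elementary_def)
  then have "card C \<le> card (\<tau> ` C)"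
    using elementary_card_le[OF assms _ _ subset_star[OF order.refl]] by simp
  then show ?thesis using \<open>finite C\<close> card_image_le[of C \<tau>] by (simp add: eq_card_imp_inj_on)
qed

text \<open>If \<open>u\<close> and \<open>w\<close> differed, both \<open>\<tau> u\<close> and
  \<open>\<tau> w\<close> would be adjacent to \<open>s\<close> in the overlap graph of the blocks
  together with \<open>s\<close>. Then \<open>S\<close>, in which \<open>s\<close> replaces these
  two blocks, meets every component and has fewer than \<open>card C\<close> elements, so the defect
  theorem contradicts elementarity.\<close>

lemma elementary_first_letter:
  assumes el: "elementary C \<tau>" and uw: "u \<in> C" "w \<in> C" and "s \<noteq> []"
    and om: "omega_power (\<tau> ` C) y" "omega_power (\<tau> ` C) z"
      "omega_power (\<tau> ` C) y'" "omega_power (\<tau> ` C) z'"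
    and eq: "s \<frown> y = \<tau> u \<frown> z" "s \<frown> y' = \<tau> w \<frown> z'"
  shows "u = w"
proof (rule ccontr)
  assume "u \<noteq> w"
  then have ne: "\<tau> u \<noteq> \<tau> w" using elementary_inj_on[OF el] uw by (auto dest: inj_onD)
  define X where "X = \<tau> ` C"
  define S where "S = insert s (X - {\<tau> u, \<tau> w})"
  have fin: "finite X" "[] \<notin> X" using el by (auto simp: elementary_def X_def)
  have uX: "\<tau> u \<in> X" "\<tau> w \<in> X" using uw by (auto simp: X_def)
  have omX: "omega_power (insert s X) x" if "omega_power X x" for x
    using that fin omega_power_subset_star subset_star by (metis subset_insertI)
  have "(\<tau> u, s) \<in> overlap_graph (insert s X)" "(\<tau> w, s) \<in> overlap_graph (insert s X)"
    using uX omX om eq unfolding overlap_graph_def X_def[symmetric] by (auto, metis+)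
  then have "\<exists>t\<in>S. (p, t) \<in> (overlap_graph (insert s X))\<^sup>*" if "p \<in> insert s X" for p
    using that unfolding S_def by blast
  moreover have "finite (insert s X)" "[] \<notin> insert s X" "S \<subseteq> insert s X"
    using fin \<open>s \<noteq> []\<close> by (auto simp: S_def)
  ultimately obtain F where F: "finite F" "[] \<notin> F" "card F \<le> card S" "insert s X \<subseteq> star F"
    using defect_theorem by metis
  then have "card C \<le> card F" using elementary_card_le[OF el] by (simp add: X_def)
  moreover have "card X \<le> card C" using el by (auto simp: elementary_def X_def card_image_le)
  moreover have "card S \<le> Suc (card (X - {\<tau> u, \<tau> w}))" unfolding S_def by (rule card_insert_le_m1) simp_all
  moreover have "card (X - {\<tau> u, \<tau> w}) = card X - card {\<tau> u, \<tau> w}"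
    using uX by (simp add: card_Diff_subset)
  \<comment> \<open>This keeps the subtraction of natural numbers above from being
    truncated.\<close>
  moreover have "card {\<tau> u, \<tau> w} \<le> card X" using uX fin by (intro card_mono) auto
  ultimately show False using F(3) ne by simp
qed

section \<open>Tilings of bi-infinite words\<close>

text \<open>
  A label \<open>(c, i)\<close> at position \<open>t\<close> says that \<open>t\<close> is the \<open>i\<close>-th position of a block \<open>\<tau> c\<close>.
\<close>

definition tile_step :: "('c \<Rightarrow> 'b list) \<Rightarrow> 'c \<times> nat \<Rightarrow> 'c \<times> nat \<Rightarrow> bool" where
  "tile_step \<tau> p q \<longleftrightarrow>
     (if Suc (snd p) < length (\<tau> (fst p)) then q = (fst p, Suc (snd p)) else snd q = 0)"

text \<open>A factorization of \<open>y\<close> into blocks, with its cuts at the labels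
  \<open>(c, 0)\<close>. Since only neighbouring labels are compared and finitely many occur for
  finite \<open>C\<close>, pigeonhole and compactness arguments apply directly.\<close>

definition tiling :: "'c set \<Rightarrow> ('c \<Rightarrow> 'b list) \<Rightarrow> (int \<Rightarrow> 'b) \<Rightarrow> (int \<Rightarrow> 'c \<times> nat) \<Rightarrow> bool" where
  "tiling C \<tau> y l \<longleftrightarrow> (\<forall>t. fst (l t) \<in> C \<and> snd (l t) < length (\<tau> (fst (l t))) \<and>
     y t = \<tau> (fst (l t)) ! snd (l t) \<and> tile_step \<tau> (l t) (l (t + 1)))"

definition tail :: "(int \<Rightarrow> 'b) \<Rightarrow> int \<Rightarrow> nat \<Rightarrow> 'b" where
  "tail y p = (\<lambda>n. y (p + int n))"

lemma tilingD:
  assumes "tiling C \<tau> y l"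
  shows "fst (l t) \<in> C" "snd (l t) < length (\<tau> (fst (l t)))"
    "y t = \<tau> (fst (l t)) ! snd (l t)" "tile_step \<tau> (l t) (l (t + 1))"
  using assms unfolding tiling_def by auto

lemma tiling_run:
  assumes "tiling C \<tau> y l" "l p = (c, i)" "i + n < length (\<tau> c)"
  shows "l (p + int n) = (c, i + n)"
  using assms(3)
proof (induction n)
  case (Suc n)
  then have "l (p + int n) = (c, i + n)" by simp
  moreover have "tile_step \<tau> (l (p + int n)) (l (p + int n + 1))" using tilingD(4)[OF assms(1)] .
  ultimately show ?case using Suc.prems by (simp add: tile_step_def add.commute add.left_commute)
qed (use assms in simp)

lemma tiling_next_cut:
  assumes "tiling C \<tau> y l" "l p = (c, i)"
  shows "snd (l (p + int (length (\<tau> c) - i))) = 0"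
proof -
  have "i < length (\<tau> c)" using tilingD(2)[OF assms(1), of p] assms(2) by simp
  define n where "n = length (\<tau> c) - i - 1"
  have n: "length (\<tau> c) - i = Suc n" "i + n < length (\<tau> c)" "\<not> Suc (i + n) < length (\<tau> c)"
    using \<open>i < length (\<tau> c)\<close> by (auto simp: n_def)
  then have "l (p + int n) = (c, i + n)" using tiling_run[OF assms] by simp
  then have "snd (l (p + int n + 1)) = 0"
    using tilingD(4)[OF assms(1), of "p + int n"] n(3) by (simp add: tile_step_def)
  then show ?thesis unfolding n(1) by (simp add: add.commute add.left_commute)
qed

lemma tiling_tail:
  assumes "tiling C \<tau> y l" "l p = (c, i)"
  shows "tail y p = drop i (\<tau> c) \<frown> tail y (p + int (length (\<tau> c) - i))"
proof
  fix n
  show "tail y p n = (drop i (\<tau> c) \<frown> tail y (p + int (length (\<tau> c) - i))) n"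
  proof (cases "i + n < length (\<tau> c)")
    case True
    then show ?thesis
      using tiling_run[OF assms True] tilingD(3)[OF assms(1), of "p + int n"] by (simp add: tail_def)
  next
    case False
    then have "int (length (\<tau> c) - i) + int (n - (length (\<tau> c) - i)) = int n" by simp
    then show ?thesis using False by (simp add: tail_def conc_def add.assoc del: of_nat_diff)
  qed
qed

lemma tiling_omega_power:
  assumes "tiling C \<tau> y l" "snd (l p) = 0"
  shows "omega_power (\<tau> ` C) (tail y p)"
proof -
  have "\<exists>p. z = tail y p \<and> snd (l p) = 0 \<Longrightarrow> omega_power (\<tau> ` C) z" for z
  proof (coinduction arbitrary: z rule: omega_power.coinduct)
    case (omega_power z)
    then obtain p where p: "z = tail y p" "snd (l p) = 0" by blast
    define c where "c = fst (l p)"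
    have lp: "l p = (c, 0)" using p(2) by (simp add: c_def prod_eq_iff)
    then have "c \<in> C" using tilingD(1)[OF assms(1), of p] by simp
    then show ?case
      using tiling_tail[OF assms(1) lp] tiling_next_cut[OF assms(1) lp] p(1) by fastforce
  qed
  then show ?thesis using assms(2) by blast
qed

lemma tiling_pred:
  assumes "tiling C \<tau> y l" "l t = (c, Suc i)"
  shows "l (t - 1) = (c, i)"
  using tilingD(4)[OF assms(1), of "t - 1"] assms(2)
  by (auto simp: tile_step_def prod_eq_iff split: if_splits)

lemma tiling_prev_cut:
  assumes "tiling C \<tau> y l"
  obtains p where "p \<le> t" "snd (l p) = 0"
proof -
  have "l t = (c, i) \<Longrightarrow> snd (l (t - int i)) = 0" for c i
  proof (induction i arbitrary: t)
    case (Suc i)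
    then have "l (t - 1) = (c, i)" using tiling_pred[OF assms] by simp
    then show ?case using Suc.IH[of "t - 1"] by (simp add: algebra_simps)
  qed simp
  from this[of "fst (l t)" "snd (l t)"] show thesis using that[of "t - int (snd (l t))"] by simp
qed

text \<open>At a common cut \<open>elementary_first_letter\<close>, with the block
  \<open>\<tau> c\<close> itself as \<open>s\<close>, shows that both tilings use the same block.
  Hence they reach their next cut together.\<close>

lemma tilings_agree_right_of_common_cut:
  assumes "elementary C \<tau>" "tiling C \<tau> y l" "tiling C \<tau> y l'" "snd (l p) = 0" "snd (l' p) = 0"
  shows "l (p + int n) = l' (p + int n)"
proof -
  have cut: "l q = l' q" if "snd (l q) = 0" "snd (l' q) = 0" for q
  proof -
    define c c' where "c = fst (l q)" and "c' = fst (l' q)"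
    have l: "l q = (c, 0)" "l' q = (c', 0)" using that by (auto simp: c_def c'_def prod_eq_iff)
    have C: "c \<in> C" "c' \<in> C"
      using tilingD(1)[OF assms(2), of q] tilingD(1)[OF assms(3), of q] by (auto simp: c_def c'_def)
    have ne: "\<tau> c \<noteq> []" using C assms(1) by (auto simp: elementary_def)
    note om = tiling_omega_power[OF assms(2) tiling_next_cut[OF assms(2) l(1)]]
      tiling_omega_power[OF assms(3) tiling_next_cut[OF assms(3) l(2)]]
    have "c = c'"
      using tiling_tail[OF assms(2) l(1)] tiling_tail[OF assms(3) l(2)]
      by (intro elementary_first_letter[OF assms(1) C ne om(1) om(1) om(1) om(2)]) simp_all
    then show ?thesis using l by simp
  qed
  show ?thesis
  proof (induction n)
    case (Suc n)
    define q where "q = p + int n"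
    have "l (q + 1) = l' (q + 1)"
      using Suc tilingD(4)[OF assms(2), of q] tilingD(4)[OF assms(3), of q] cut[of "q + 1"]
      by (auto simp: q_def[symmetric] tile_step_def split: if_splits)
    then show ?case by (simp add: q_def add.commute add.left_commute)
  qed (use assms cut in simp)
qed

text \<open>The rest \<open>drop i (\<tau> c)\<close> of the block of \<open>l'\<close> is the same
  at \<open>p\<close> and at \<open>q\<close>. It is the word \<open>s\<close> of
  \<open>elementary_first_letter\<close>: followed by blocks of \<open>l'\<close>, it gives the tail
  of \<open>y\<close>, which also starts with the block of \<open>l\<close> at \<open>p\<close> or
  \<open>q\<close>.\<close>

lemma label_determined_by_other_tiling:
  assumes "elementary C \<tau>" "tiling C \<tau> y l" "tiling C \<tau> y l'"
    and "snd (l p) = 0" "snd (l q) = 0" "l' p = l' q"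
  shows "l p = l q"
proof -
  define u w where "u = fst (l p)" and "w = fst (l q)"
  have l: "l p = (u, 0)" "l q = (w, 0)" using assms(4,5) by (auto simp: u_def w_def prod_eq_iff)
  obtain c i where c: "l' p = (c, i)" "l' q = (c, i)" using assms(6) by (metis surj_pair)
  have C: "u \<in> C" "w \<in> C"
    using tilingD(1)[OF assms(2), of p] tilingD(1)[OF assms(2), of q] by (auto simp: u_def w_def)
  have ne: "drop i (\<tau> c) \<noteq> []" using tilingD(2)[OF assms(3), of p] c(1) by simp
  note om = tiling_omega_power[OF assms(3) tiling_next_cut[OF assms(3) c(1)]]
    tiling_omega_power[OF assms(2) tiling_next_cut[OF assms(2) l(1)]]
    tiling_omega_power[OF assms(3) tiling_next_cut[OF assms(3) c(2)]]
    tiling_omega_power[OF assms(2) tiling_next_cut[OF assms(2) l(2)]]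
  have "u = w"
    using tiling_tail[OF assms(3) c(1)] tiling_tail[OF assms(3) c(2)]
      tiling_tail[OF assms(2) l(1)] tiling_tail[OF assms(2) l(2)]
    by (intro elementary_first_letter[OF assms(1) C ne om]) simp_all
  then show ?thesis using l by simp
qed

text \<open>Moving right from \<open>p\<close> and \<open>q\<close> in parallel, at least one of the
  two tilings is always in the interior of a block. Its label is forced by the previous one, and it
  determines the label of the other tiling at a cut.\<close>

lemma tilings_repeat:
  assumes el: "elementary C \<tau>" and t: "tiling C \<tau> y l" "tiling C \<tau> y l'" and "p \<noteq> q"
    and "l p = l q" "l' p = l' q"
    and "\<And>c. snd (l c) = 0 \<Longrightarrow> snd (l' c) = 0 \<Longrightarrow> p < c \<and> q < c"
  shows "l (p + int n) = l (q + int n)"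
proof -
  have "l (p + int n) = l (q + int n) \<and> l' (p + int n) = l' (q + int n) \<and>
    (\<forall>c. snd (l c) = 0 \<longrightarrow> snd (l' c) = 0 \<longrightarrow> p + int n < c \<and> q + int n < c)"
  proof (induction n)
    case (Suc n)
    define p' q' where "p' = p + int n" and "q' = q + int n"
    have IH: "l p' = l q'" "l' p' = l' q'" "p' \<noteq> q'"
      and no: "\<And>c. snd (l c) = 0 \<Longrightarrow> snd (l' c) = 0 \<Longrightarrow> p' < c \<and> q' < c"
      using Suc assms(4) by (auto simp: p'_def q'_def)
    note steps = tilingD(4)[OF t(1), of p'] tilingD(4)[OF t(1), of q']
      tilingD(4)[OF t(2), of p'] tilingD(4)[OF t(2), of q']
    \<comment> \<open>If both new positions were common cuts, the invariant would place each of them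
      to the right of both \<open>p'\<close> and \<open>q'\<close>, which forces
      \<open>p' = q'\<close>.\<close>
    have not_both: "\<not> (snd (l (p' + 1)) = 0 \<and> snd (l' (p' + 1)) = 0 \<and>
      snd (l (q' + 1)) = 0 \<and> snd (l' (q' + 1)) = 0)"
    proof
      assume "snd (l (p' + 1)) = 0 \<and> snd (l' (p' + 1)) = 0 \<and>
        snd (l (q' + 1)) = 0 \<and> snd (l' (q' + 1)) = 0"
      then have "q' < p' + 1" "p' < q' + 1" using no by blast+
      then show False using IH(3) by simp
    qed
    then have eq: "l (p' + 1) = l (q' + 1) \<and> l' (p' + 1) = l' (q' + 1)"
      using steps IH label_determined_by_other_tiling[OF el t, of "p' + 1" "q' + 1"]
        label_determined_by_other_tiling[OF el t(2) t(1), of "p' + 1" "q' + 1"]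
      by (auto simp: tile_step_def split: if_splits)
    \<comment> \<open>By equality of labels, a common cut at one of the new positions would be one
      at both, which \<open>not_both\<close> excludes.\<close>
    moreover have "p' + 1 < c \<and> q' + 1 < c" if "snd (l c) = 0" "snd (l' c) = 0" for c
    proof -
      have "c \<noteq> p' + 1" "c \<noteq> q' + 1"
        using that eq not_both by auto
      then show ?thesis using no[OF that] by auto
    qed
    ultimately show ?case by (simp add: p'_def q'_def algebra_simps)
  qed (use assms in auto)
  then show ?thesis by blast
qed

lemma finite_tile_labels:
  assumes "finite C"
  shows "finite {q. fst q \<in> C \<and> snd q < length (\<tau> (fst q))}"
proof -
  have "{q. fst q \<in> C \<and> snd q < length (\<tau> (fst q))} = (SIGMA c:C. {..<length (\<tau> c)})" by auto
  then show ?thesis using assms by simp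
qed

lemma elementary_unique_tiling:
  assumes el: "elementary C \<tau>" and t: "tiling C \<tau> y l" "tiling C \<tau> y l'" and ap: "aperiodic y"
  shows "l = l'"
proof (cases "\<forall>b. \<exists>c\<le>b. snd (l c) = 0 \<and> snd (l' c) = 0")
  case True
  show ?thesis
  proof
    fix s
    obtain c where "c \<le> s" "snd (l c) = 0" "snd (l' c) = 0" using True by blast
    then show "l s = l' s"
      using tilings_agree_right_of_common_cut[OF el t, of c "nat (s - c)"] by simp
  qed
next
  case False
  then obtain b where b: "\<And>c. snd (l c) = 0 \<Longrightarrow> snd (l' c) = 0 \<Longrightarrow> b < c"
    by (meson not_le_imp_less)
  define P where "P = {p. p \<le> b \<and> snd (l p) = 0}"
  \<comment> \<open>Among positions up to \<open>b\<close>, infinitely many means arbitrarily far to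
    the left; this makes the pigeonhole principle usable for cuts.\<close>
  have unbounded_below: "\<not> finite Q \<longleftrightarrow> (\<forall>a. \<exists>p\<in>Q. p \<le> a)" if "Q \<subseteq> {..b}" for Q :: "int set"
  proof
    assume inf: "\<not> finite Q"
    show "\<forall>a. \<exists>p\<in>Q. p \<le> a"
    proof (rule ccontr)
      assume "\<not> ?thesis"
      then obtain a where "\<forall>p\<in>Q. \<not> p \<le> a" by blast
      then have "Q \<subseteq> {a..b}" using \<open>Q \<subseteq> {..b}\<close> by force
      then show False using inf finite_subset by blast
    qed
  next
    assume *: "\<forall>a. \<exists>p\<in>Q. p \<le> a"
    show "\<not> finite Q"
    proof
      assume "finite Q"
      moreover obtain p where "p \<in> Q" "p \<le> Min Q - 1" using * by blast
      ultimately show False using Min_le[of Q p] by linarith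
    qed
  qed
  have "\<not> finite P"
  proof (subst unbounded_below)
    show "\<forall>a. \<exists>p\<in>P. p \<le> a"
    proof
      fix a
      obtain p where "p \<le> min a b" "snd (l p) = 0" using tiling_prev_cut[OF t(1)] by blast
      then show "\<exists>p\<in>P. p \<le> a" by (auto simp: P_def)
    qed
  qed (auto simp: P_def)
  moreover have "finite (l' ` P)"
  proof (rule finite_subset)
    show "l' ` P \<subseteq> {q. fst q \<in> C \<and> snd q < length (\<tau> (fst q))}"
      using tilingD(1,2)[OF t(2)] by auto
    show "finite {q. fst q \<in> C \<and> snd q < length (\<tau> (fst q))}"
      using el by (intro finite_tile_labels) (simp add: elementary_def)
  qed
  ultimately obtain p0 where "\<not> finite {p \<in> P. l' p = l' p0}" using pigeonhole_infinite by blast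
  moreover define Q where "Q = {p \<in> P. l' p = l' p0}"
  ultimately have Q: "\<exists>p\<in>Q. p \<le> a" for a
    using unbounded_below[of Q] by (auto simp: P_def)
  have rep: "y (p + int n) = y (q + int n)" if "p \<in> Q" "q \<in> Q" for p q n
  proof (cases "p = q")
    case False
    have PQ: "snd (l p) = 0" "snd (l q) = 0" "l' p = l' q" "p \<le> b" "q \<le> b"
      using that by (auto simp: Q_def P_def)
    have "l p = l q" using label_determined_by_other_tiling[OF el t PQ(1-3)] .
    moreover have "p < c \<and> q < c" if "snd (l c) = 0" "snd (l' c) = 0" for c
      using b[OF that] PQ by simp
    ultimately have "l (p + int n) = l (q + int n)" using PQ(3) by (intro tilings_repeat[OF el t False])
    then show ?thesis using tilingD(3)[OF t(1)] by metis
  qed simp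
  obtain q where q: "q \<in> Q" using Q by blast
  obtain p where p: "p \<in> Q" "p \<le> q - 1" using Q by blast
  \<comment> \<open>Choose \<open>r \<in> Q\<close> to the left of \<open>s\<close>. The tails of
    \<open>y\<close> at \<open>p\<close>, \<open>q\<close> and \<open>r\<close> coincide, so passing
    from \<open>r\<close> to \<open>q\<close>, reading this position relative to \<open>p\<close>,
    and returning to \<open>r\<close> moves \<open>s\<close> by \<open>q - p\<close>.\<close>
  have "y (s + (q - p)) = y s" for s
  proof -
    obtain r where r: "r \<in> Q" "r \<le> s" using Q by blast
    define n where "n = nat (s - r)"
    have "y s = y (r + int n)" using r by (simp add: n_def)
    also have "\<dots> = y (q + int n)" using rep r(1) q by blast
    also have "\<dots> = y (p + int (n + nat (q - p)))" using p by (simp add: algebra_simps)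
    also have "\<dots> = y (r + int (n + nat (q - p)))" using rep r(1) p(1) by blast
    also have "\<dots> = y (s + (q - p))" using r p by (simp add: n_def)
    finally show ?thesis by simp
  qed
  then have "shift (q - p) y = y" by (simp add: shift_def fun_eq_iff)
  then have "periodic y" using p(2) by (auto simp: periodic_def intro!: exI[of _ "q - p"])
  then show ?thesis using ap by simp
qed

section \<open>Representations and tilings\<close>

text \<open>Describes a representation by local data, as a tiling does, but keeps the index of the
  block in \<open>x\<close> rather than only its letter, so that \<open>x\<close> can be
  recovered.\<close>

definition block_index ::
    "('a \<Rightarrow> 'b list) \<Rightarrow> (int \<Rightarrow> 'a) \<Rightarrow> (int \<Rightarrow> 'b) \<Rightarrow> (int \<Rightarrow> int \<times> nat) \<Rightarrow> bool" where
  "block_index s x y J \<longleftrightarrow> (\<forall>t. snd (J t) < length (s (x (fst (J t)))) \<and>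
     y t = s (x (fst (J t))) ! snd (J t) \<and>
     J (t + 1) = (if Suc (snd (J t)) < length (s (x (fst (J t)))) then (fst (J t), Suc (snd (J t)))
       else (fst (J t) + 1, 0)))"

lemma block_indexD:
  assumes "block_index s x y J"
  shows "snd (J t) < length (s (x (fst (J t))))" "y t = s (x (fst (J t))) ! snd (J t)"
    "J (t + 1) = (if Suc (snd (J t)) < length (s (x (fst (J t)))) then (fst (J t), Suc (snd (J t)))
       else (fst (J t) + 1, 0))"
  using assms unfolding block_index_def by blast+

lemma block_index_exists:
  assumes ne: "\<And>i. s (x i) \<noteq> []" and y: "y = shift k (ext_seq s x)"
    and k: "0 \<le> k" "k < int (length (s (x 0)))"
  obtains J where "block_index s x y J" "\<And>j. \<exists>t. fst (J t) = j" "J 0 = (0, nat k)"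
proof -
  define L where "L j = int (length (s (x j)))" for j
  have L: "1 \<le> L j" for j using ne[of j] by (cases "s (x j)") (auto simp: L_def)
  \<comment> \<open>The block of \<open>x j\<close> starts at position \<open>pos j\<close> of
    \<open>ext_seq s x\<close>.\<close>
  define pos where "pos j = (if 0 \<le> j then int (length (ext_word s (map x [0..j-1])))
    else - int (length (ext_word s (map x [j..-1]))))" for j
  have pos0: "pos 0 = 0" by (simp add: pos_def ext_word_def)
  have pos_succ: "pos (j + 1) = pos j + L j" for j
  proof (cases "0 \<le> j")
    case True
    then show ?thesis by (simp add: pos_def ext_word_def L_def upto_rec2)
  next
    case False
    then have "[j..-1] = j # [j+1..-1]" by (simp add: upto_rec1)
    then show ?thesis using False by (auto simp: pos_def ext_word_def L_def)
  qed
  have val: "ext_seq s x (pos j + int p) = s (x j) ! p" if "p < length (s (x j))" for j p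
  proof (cases "0 \<le> j")
    case True
    then show ?thesis using ext_seq_nonneg[of s x, OF ne True that] by (simp add: pos_def)
  next
    case False
    then show ?thesis using ext_seq_neg[of s x, OF ne _ that] by (simp add: pos_def)
  qed
  have ex: "\<exists>j p. p < length (s (x j)) \<and> m = pos j + int p" for m
  proof (induction m rule: int_induct[of _ 0])
    case base
    then show ?case using pos0 ne[of 0] by (intro exI[of _ 0]) auto
  next
    case (step1 m)
    then obtain j p where jp: "p < length (s (x j))" "m = pos j + int p" by blast
    show ?case
    proof (cases "Suc p < length (s (x j))")
      case True
      then show ?thesis using jp by (intro exI[of _ j] exI[of _ "Suc p"]) auto
    next
      case False
      then have "m + 1 = pos (j + 1) + int 0" using jp by (simp add: pos_succ L_def)
      then show ?thesis using ne[of "j + 1"] by blast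
    qed
  next
    case (step2 m)
    then obtain j p where jp: "p < length (s (x j))" "m = pos j + int p" by blast
    show ?case
    proof (cases p)
      case (Suc p')
      then show ?thesis using jp by (intro exI[of _ j] exI[of _ p']) auto
    next
      case 0
      then have "m - 1 = pos (j - 1) + int (length (s (x (j - 1))) - 1)"
        using jp pos_succ[of "j - 1"] L[of "j - 1"] by (simp add: L_def of_nat_diff)
      moreover have "length (s (x (j - 1))) - 1 < length (s (x (j - 1)))" using ne[of "j - 1"] by simp
      ultimately show ?thesis by blast
    qed
  qed
  have pos_mono: "pos i + L i \<le> pos j" if "i < j" for i j
  proof -
    have "i + 1 \<le> j" using that by simp
    then show ?thesis
    proof (induction j rule: int_ge_induct)
      case (step j)
      then show ?case using L[of j] pos_succ[of j] by simp
    qed (simp add: pos_succ)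
  qed
  have uniq: "i = j \<and> p = q"
    if "p < length (s (x i))" "q < length (s (x j))" "pos i + int p = pos j + int q" for i j p q
  proof -
    have "\<not> i < j" "\<not> j < i" using that pos_mono[of i j] pos_mono[of j i] by (auto simp: L_def)
    then show ?thesis using that(3) by (cases i j rule: linorder_cases) auto
  qed
  have "\<forall>t. \<exists>q. snd q < length (s (x (fst q))) \<and> t + k = pos (fst q) + int (snd q)"
    using ex by (metis fst_conv snd_conv)
  then obtain J where J: "\<And>t. snd (J t) < length (s (x (fst (J t))))"
    "\<And>t. t + k = pos (fst (J t)) + int (snd (J t))"
    by metis
  have J_eq: "J t = (j, p)" if "p < length (s (x j))" "t + k = pos j + int p" for t j p
    using uniq[OF J(1)[of t] that(1)] J(2)[of t] that(2) by (simp add: prod_eq_iff)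
  have "J (t + 1) = (if Suc (snd (J t)) < length (s (x (fst (J t)))) then (fst (J t), Suc (snd (J t)))
       else (fst (J t) + 1, 0))" for t
  proof (cases "Suc (snd (J t)) < length (s (x (fst (J t))))")
    case True
    then have "J (t + 1) = (fst (J t), Suc (snd (J t)))" using J(2)[of t] by (intro J_eq) auto
    then show ?thesis using True by simp
  next
    case False
    then have "int (length (s (x (fst (J t))))) = int (snd (J t)) + 1" using J(1)[of t] by simp
    then have "J (t + 1) = (fst (J t) + 1, 0)"
      using J(2)[of t] ne by (intro J_eq) (auto simp: pos_succ L_def)
    then show ?thesis using False by simp
  qed
  then have "block_index s x y J"
    unfolding block_index_def y shift_def J(2) using J(1) val by blast
  moreover have "\<exists>t. fst (J t) = j" for j
  proof
    show "fst (J (pos j - k)) = j" using J_eq[of 0 j "pos j - k"] ne by simp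
  qed
  \<comment> \<open>Centeredness puts position 0 of \<open>y\<close>, which is position
    \<open>k\<close> of \<open>ext_seq s x\<close>, into the block of \<open>x 0\<close>.\<close>
  moreover have "J 0 = (0, nat k)" using k pos0 by (intro J_eq) auto
  ultimately show thesis using that by blast
qed

text \<open>Both indices are 0 at position 0. Since letters and offsets agree, both pass to a new
  block at the same positions, so the indices agree everywhere.\<close>

lemma block_index_unique:
  assumes J: "block_index s x y J" "\<And>j. \<exists>t. fst (J t) = j" "fst (J 0) = 0"
    and J': "block_index s x' y J'" "fst (J' 0) = 0"
    and eq: "\<And>t. x (fst (J t)) = x' (fst (J' t))" "\<And>t. snd (J t) = snd (J' t)"
  shows "x = x'"
proof -
  have "fst (J t) = fst (J' t)" for t
  proof (induction t rule: int_induct[of _ 0])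
    case base
    show ?case using J J' by simp
  next
    case (step1 t)
    then show ?case using block_indexD(3)[OF J(1), of t] block_indexD(3)[OF J'(1), of t] eq[of t]
      by simp
  next
    case (step2 t)
    then show ?case
      using block_indexD(3)[OF J(1), of "t - 1"] block_indexD(3)[OF J'(1), of "t - 1"] eq[of "t - 1"]
      by (simp split: if_splits)
  qed
  then show ?thesis using J(2) eq(1) by (metis ext)
qed

section \<open>Positions in the image of a finite word\<close>

lemma length_ext_word_take_Suc:
  "i < length f \<Longrightarrow>
    length (ext_word s (take (Suc i) f)) = length (ext_word s (take i f)) + length (s (f ! i))"
  by (simp add: ext_word_def take_Suc_conv_app_nth)

lemma length_ext_word_take_mono:
  assumes "i \<le> j"
  shows "length (ext_word s (take i f)) \<le> length (ext_word s (take j f))"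
proof -
  have "take j f = take i f @ take (j - i) (drop i f)" using assms by (metis le_add_diff_inverse take_add)
  then show ?thesis by (simp add: ext_word_def)
qed

lemma ext_word_nth:
  assumes "i < length f" "p < length (s (f ! i))"
  shows "ext_word s f ! (length (ext_word s (take i f)) + p) = s (f ! i) ! p"
proof -
  have "ext_word s f = ext_word s (take i f) @ s (f ! i) @ ext_word s (drop (Suc i) f)"
    using id_take_nth_drop[OF assms(1)] by (metis concat.simps(2) concat_append ext_word_def list.map(2) map_append)
  then show ?thesis using assms(2) by (simp add: nth_append)
qed

lemma ext_word_position_unique:
  assumes "i < length f" "j < length f" "p < length (s (f ! i))" "q < length (s (f ! j))"
    and eq: "length (ext_word s (take i f)) + p = length (ext_word s (take j f)) + q"
  shows "i = j \<and> p = q"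
proof -
  have "\<not> i < j" "\<not> j < i"
    using length_ext_word_take_mono[of "Suc i" j s f] length_ext_word_take_mono[of "Suc j" i s f]
      length_ext_word_take_Suc[of _ f s] assms by fastforce+
  then show ?thesis using eq by (cases i j rule: linorder_cases) auto
qed

text \<open>Composes two levels: position \<open>t\<close> lies in the image of a letter of
  \<open>x\<close>, and that letter lies in a word \<open>f\<close> of the tiling of
  \<open>x\<close>. The offset therefore adds the lengths of the images of the preceding letters of
  \<open>f\<close>.\<close>

definition lift_tiling ::
    "('a \<Rightarrow> 'b list) \<Rightarrow> (int \<Rightarrow> 'a list \<times> nat) \<Rightarrow> (int \<Rightarrow> int \<times> nat) \<Rightarrow> int \<Rightarrow> 'a list \<times> nat" where
  "lift_tiling s l J t = (let (f, i) = l (fst (J t))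
     in (f, length (ext_word s (take i f)) + snd (J t)))"

lemma tiling_lift_tiling:
  assumes J: "block_index s x y J" and l: "tiling F id x l"
  shows "tiling F (ext_word s) y (lift_tiling s l J)"
  unfolding tiling_def
proof
  fix t
  obtain j p where jp: "J t = (j, p)" by fastforce
  obtain f i where fi: "l j = (f, i)" by fastforce
  have i: "f \<in> F" "i < length f" "x j = f ! i" using tilingD(1-3)[OF l, of j] fi by auto
  have p: "p < length (s (f ! i))" "y t = s (f ! i) ! p" using block_indexD[OF J, of t] jp i by auto
  have lt: "lift_tiling s l J t = (f, length (ext_word s (take i f)) + p)"
    by (simp add: lift_tiling_def jp fi)
  have le: "length (ext_word s (take i f)) + length (s (f ! i)) \<le> length (ext_word s f)"
    using length_ext_word_take_mono[of "Suc i" "length f" s f] length_ext_word_take_Suc[OF i(2), of s] i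
    by simp
  have step: "tile_step (ext_word s) (lift_tiling s l J t) (lift_tiling s l J (t + 1))"
  proof (cases "Suc p < length (s (f ! i))")
    case True
    then have "lift_tiling s l J (t + 1) = (f, length (ext_word s (take i f)) + Suc p)"
      using block_indexD(3)[OF J, of t] jp fi i by (simp add: lift_tiling_def)
    then show ?thesis using True le lt by (simp add: tile_step_def)
  next
    case False
    then have J1: "J (t + 1) = (j + 1, 0)" using block_indexD(3)[OF J, of t] jp i by simp
    have len: "length (s (f ! i)) = Suc p" using False p by simp
    show ?thesis
    proof (cases "Suc i < length f")
      case True
      then have l1: "l (j + 1) = (f, Suc i)" using tilingD(4)[OF l, of j] fi by (simp add: tile_step_def)
      then have "x (j + 1) = f ! Suc i" using tilingD(3)[OF l, of "j + 1"] by simp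
      \<comment> \<open>The image of the next letter is non-empty, so the end of the present one is
        not the end of \<open>ext_word s f\<close>, and \<open>tile_step\<close> has to stay in the
        same block.\<close>
      then have "0 < length (s (f ! Suc i))" using block_indexD(1)[OF J, of "t + 1"] J1 by simp
      then have "length (ext_word s (take (Suc i) f)) < length (ext_word s f)"
        using length_ext_word_take_Suc[OF True, of s]
          length_ext_word_take_mono[of "Suc (Suc i)" "length f" s f]
        unfolding take_all[OF order.refl] using True by linarith
      then show ?thesis
        using lt J1 l1 length_ext_word_take_Suc[OF i(2), of s] len
        by (simp add: lift_tiling_def tile_step_def)
    next
      case False
      then have "snd (l (j + 1)) = 0" using tilingD(4)[OF l, of j] fi by (simp add: tile_step_def)
      moreover have "length (ext_word s f) = length (ext_word s (take i f)) + Suc p"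
        using False i length_ext_word_take_Suc[OF i(2), of s] len by simp
      moreover have "snd (lift_tiling s l J (t + 1)) = 0"
        using \<open>snd (l (j + 1)) = 0\<close> J1 by (simp add: lift_tiling_def case_prod_beta ext_word_def)
      ultimately show ?thesis by (simp add: tile_step_def lt)
    qed
  qed
  show "fst (lift_tiling s l J t) \<in> F \<and>
    snd (lift_tiling s l J t) < length (ext_word s (fst (lift_tiling s l J t))) \<and>
    y t = ext_word s (fst (lift_tiling s l J t)) ! snd (lift_tiling s l J t) \<and>
    tile_step (ext_word s) (lift_tiling s l J t) (lift_tiling s l J (t + 1))"
    using step i p le ext_word_nth[of i f p s] by (simp add: lt)
qed

lemma lift_tiling_eqD:
  assumes "block_index s x y J" "tiling F id x l" "block_index s x' y J'" "tiling F id x' l'"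
    and "lift_tiling s l J t = lift_tiling s l' J' t"
  shows "x (fst (J t)) = x' (fst (J' t)) \<and> snd (J t) = snd (J' t)"
proof -
  define i i' f f' where "i = snd (l (fst (J t)))" and "i' = snd (l' (fst (J' t)))"
    and "f = fst (l (fst (J t)))" and "f' = fst (l' (fst (J' t)))"
  have "f = f'" and len: "length (ext_word s (take i f)) + snd (J t)
      = length (ext_word s (take i' f')) + snd (J' t)"
    using assms(5) by (auto simp: lift_tiling_def case_prod_beta i_def i'_def f_def f'_def)
  have i: "i < length f" "i' < length f'" "x (fst (J t)) = f ! i" "x' (fst (J' t)) = f' ! i'"
    using tilingD(2,3)[OF assms(2), of "fst (J t)"] tilingD(2,3)[OF assms(4), of "fst (J' t)"]
    by (auto simp: i_def i'_def f_def f'_def)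
  have "i = i' \<and> snd (J t) = snd (J' t)"
    using i len block_indexD(1)[OF assms(1), of t] block_indexD(1)[OF assms(3), of t] \<open>f = f'\<close>
    by (intro ext_word_position_unique[of _ f _ _ s]) auto
  then show ?thesis using i \<open>f = f'\<close> by simp
qed

text \<open>Two centered representations of \<open>y\<close> lift to tilings of \<open>y\<close> by
  images of words of \<open>F\<close>, and these tilings coincide. Their labels reveal the letter
  and the offset at every position, hence \<open>x\<close> and \<open>k\<close>.\<close>

lemma recognizable_of_elementary:
  assumes mor: "morphism A B s" and el: "elementary F (ext_word s)"
    and tile: "\<And>x. x \<in> X \<Longrightarrow> \<exists>l. tiling F id x l"
  shows "recognizable_for_aperiodic A B s X"
  unfolding recognizable_for_aperiodic_def
proof (intro ballI impI Uniq_I)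
  fix y r r'
  assume ap: "aperiodic y"
    and r: "representation A s y r \<and> centered s r \<and> snd r \<in> X"
    and r': "representation A s y r' \<and> centered s r' \<and> snd r' \<in> X"
  obtain k x k' x' where rr: "r = (k, x)" "r' = (k', x')" by fastforce
  have "x i \<in> A" "x' i \<in> A" for i
    using r r' rr by (auto simp: representation_def full_shift_def)
  then have ne: "s (x i) \<noteq> []" "s (x' i) \<noteq> []" for i using mor by (simp_all add: morphism_def)
  have k: "y = shift k (ext_seq s x)" "0 \<le> k" "k < int (length (s (x 0)))"
    and k': "y = shift k' (ext_seq s x')" "0 \<le> k'" "k' < int (length (s (x' 0)))"
    using r r' rr by (auto simp: representation_def centered_def)
  obtain J where J: "block_index s x y J" "\<And>j. \<exists>t. fst (J t) = j" "J 0 = (0, nat k)"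
    using block_index_exists[of s x, OF ne(1) k] by blast
  obtain J' where J': "block_index s x' y J'" "J' 0 = (0, nat k')"
    using block_index_exists[of s x', OF ne(2) k'] by blast
  obtain l l' where l: "tiling F id x l" "tiling F id x' l'" using tile r r' rr by fastforce
  have "lift_tiling s l J = lift_tiling s l' J'"
    using elementary_unique_tiling[OF el tiling_lift_tiling[OF J(1) l(1)]
        tiling_lift_tiling[OF J'(1) l(2)] ap] .
  then have eq: "x (fst (J t)) = x' (fst (J' t))" "snd (J t) = snd (J' t)" for t
    using lift_tiling_eqD[OF J(1) l(1) J'(1) l(2), of t] by simp_all
  have "x = x'" using block_index_unique[OF J(1,2) _ J'(1) _ eq] J(3) J'(2) by simp
  moreover have "k = k'" using eq(2)[of 0] J(3) J'(2) k(2) k'(2) by simp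
  ultimately show "r = r'" using rr by simp
qed

section \<open>Compactness\<close>

text \<open>Compactness by a diagonal argument: nested infinite sets \<open>H M\<close> of indices
  are chosen such that the sequences \<open>f m\<close> with \<open>m \<in> H M\<close> agree on the
  window of radius \<open>M\<close>.\<close>

lemma agreeing_limit:
  fixes f :: "nat \<Rightarrow> int \<Rightarrow> 'c"
  assumes fin: "finite L" and f: "\<And>m t. \<bar>t\<bar> \<le> int m \<Longrightarrow> f m t \<in> L"
  obtains g where "\<And>M. \<exists>m\<ge>M. \<forall>t. \<bar>t\<bar> \<le> int M \<longrightarrow> g t = f m t"
proof -
  define P where "P M H \<longleftrightarrow> infinite H \<and> (\<forall>m\<in>H. \<forall>m'\<in>H. \<forall>t. \<bar>t\<bar> \<le> int M \<longrightarrow> f m t = f m' t)"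
    for M and H :: "nat set"
  have step: "\<exists>H'. P M H' \<and> H' \<subseteq> H" if H: "infinite H" for M H
  proof -
    \<comment> \<open>For \<open>m < M\<close> the values of \<open>f m\<close> on the window of
      radius \<open>M\<close> need not lie in \<open>L\<close>.\<close>
    define H0 where "H0 = H - {..<M}"
    define R where "R m = restrict (f m) {- int M..int M}" for m
    have "infinite H0" using H by (simp add: H0_def Diff_infinite_finite)
    moreover have "finite (R ` H0)"
    proof (rule finite_subset)
      show "R ` H0 \<subseteq> (\<Pi>\<^sub>E t\<in>{- int M..int M}. L)"
        using f by (auto simp: R_def H0_def)
      show "finite (\<Pi>\<^sub>E t\<in>{- int M..int M}. L)" using fin by (intro finite_PiE) auto
    qed
    ultimately obtain m0 where "infinite {m \<in> H0. R m = R m0}" using pigeonhole_infinite by blast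
    moreover have "f m t = f m0 t" if "R m = R m0" "\<bar>t\<bar> \<le> int M" for m t
      using fun_cong[OF that(1), of t] that(2) by (simp add: R_def restrict_def abs_le_iff split: if_splits)
    then have "f m t = f m' t" if "R m = R m0" "R m' = R m0" "\<bar>t\<bar> \<le> int M" for m m' t
      using that by metis
    ultimately have "P M {m \<in> H0. R m = R m0}" unfolding P_def by blast
    then show ?thesis by (auto simp: H0_def)
  qed
  have "\<exists>H. \<forall>M. P M (H M) \<and> H (Suc M) \<subseteq> H M"
  proof (rule dependent_nat_choice[of P "\<lambda>_ H H'. H' \<subseteq> H"])
    show "\<exists>H. P 0 H" using step[of UNIV 0] by auto
    show "\<exists>H'. P (Suc M) H' \<and> H' \<subseteq> H" if "P M H" for H M
      using step[of H "Suc M"] that by (simp add: P_def)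
  qed
  then obtain H where H: "\<And>M. P M (H M)" "\<And>M. H (Suc M) \<subseteq> H M" by blast
  have mono: "H M \<subseteq> H N" if "N \<le> M" for M N
    using H(2) that by (rule lift_Suc_antimono_le)
  define h where "h M = (SOME m. m \<in> H M)" for M
  have h: "h M \<in> H M" for M
    unfolding h_def some_in_eq using H(1)[of M] by (auto simp: P_def)
  show thesis
  proof
    fix M
    obtain m where m: "m \<in> H M" "M \<le> m" 
      using H(1)[of M] infinite_nat_iff_unbounded_le[of "H M"] unfolding P_def by blast
    \<comment> \<open>The limit takes its value at \<open>t\<close> from the smallest window
      containing \<open>t\<close>; as the sets are nested, \<open>m\<close> belongs to the
      corresponding set as well.\<close>
    have "f (h (nat \<bar>t\<bar>)) t = f m t" if "\<bar>t\<bar> \<le> int M" for t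
    proof -
      have "m \<in> H (nat \<bar>t\<bar>)" using mono[of "nat \<bar>t\<bar>" M] m(1) that by (auto simp: nat_le_iff)
      moreover have "\<bar>t\<bar> \<le> int (nat \<bar>t\<bar>)" by simp
      ultimately show ?thesis using H(1)[of "nat \<bar>t\<bar>"] h[of "nat \<bar>t\<bar>"] unfolding P_def by blast
    qed
    then show "\<exists>m\<ge>M. \<forall>t. \<bar>t\<bar> \<le> int M \<longrightarrow> f (h (nat \<bar>t\<bar>)) t = f m t" using m by blast
  qed
qed

definition block_labels :: "'a list list \<Rightarrow> ('a list \<times> nat) list" where
  "block_labels ws = concat (map (\<lambda>f. map (Pair f) [0..<length f]) ws)"

lemma block_labels_Cons: "block_labels (f # ws) = map (Pair f) [0..<length f] @ block_labels ws"
  by (simp add: block_labels_def)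

lemma length_block_labels: "length (block_labels ws) = length (concat ws)"
  by (induction ws) (simp_all add: block_labels_def)

lemma block_labels_nth:
  assumes "i < length (concat ws)"
  shows "fst (block_labels ws ! i) \<in> set ws \<and>
    snd (block_labels ws ! i) < length (fst (block_labels ws ! i)) \<and>
    concat ws ! i = fst (block_labels ws ! i) ! snd (block_labels ws ! i)"
  using assms
proof (induction ws arbitrary: i)
  case (Cons f ws)
  show ?case
  proof (cases "i < length f")
    case True
    then show ?thesis by (simp add: block_labels_Cons nth_append)
  next
    case False
    then show ?thesis using Cons.IH[of "i - length f"] Cons.prems
      by (simp add: block_labels_Cons nth_append)
  qed
qed simp

lemma block_labels_first:
  assumes "[] \<notin> set ws" "ws \<noteq> []"
  shows "snd (block_labels ws ! 0) = 0"
  using assms by (cases ws) (auto simp: block_labels_Cons nth_append)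

lemma block_labels_step:
  assumes "[] \<notin> set ws" "Suc i < length (concat ws)"
  shows "tile_step id (block_labels ws ! i) (block_labels ws ! Suc i)"
  using assms
proof (induction ws arbitrary: i)
  case (Cons f ws)
  consider "Suc i < length f" | "Suc i = length f" | "length f \<le> i" by linarith
  then show ?case
  proof cases
    case 1
    then show ?thesis by (simp add: block_labels_Cons nth_append tile_step_def)
  next
    case 2
    then have "ws \<noteq> []" using Cons.prems by auto
    then show ?thesis using 2 block_labels_first[of ws] Cons.prems
      by (simp add: block_labels_Cons nth_append tile_step_def)
  next
    case 3
    then show ?thesis using Cons.IH[of "i - length f"] Cons.prems
      by (simp add: block_labels_Cons nth_append Suc_diff_le)
  qed
qed simp

text \<open>The labels of a product of words of \<open>F\<close>, restricted to a window it
  contains, form a partial tiling of \<open>x\<close>. A limit of these as the windows grow is a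
  tiling.\<close>

lemma tiling_of_windows:
  assumes F: "finite F" "[] \<notin> F"
    and win: "\<And>m. \<exists>w\<in>star F. sublist (map x [- int m..int m]) w"
  shows "\<exists>l. tiling F id x l"
proof -
  have "\<exists>l. (\<forall>t. \<bar>t\<bar> \<le> int m \<longrightarrow> fst (l t) \<in> F \<and> snd (l t) < length (fst (l t)) \<and>
      x t = fst (l t) ! snd (l t)) \<and>
    (\<forall>t. - int m \<le> t \<longrightarrow> t < int m \<longrightarrow> tile_step id (l t) (l (t + 1)))" for m
  proof -
    obtain ws where ws: "ws \<in> lists F" "sublist (map x [- int m..int m]) (concat ws)"
      using win[of m] by blast
    then obtain u v where uv: "concat ws = u @ map x [- int m..int m] @ v" by (auto simp: sublist_def)
    define l where "l t = block_labels ws ! (length u + nat (t + int m))" for t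
    have len: "length u + nat (t + int m) < length (concat ws)" if "\<bar>t\<bar> \<le> int m" for t
      using that by (auto simp: uv)
    have "concat ws ! (length u + nat (t + int m)) = x t" if "\<bar>t\<bar> \<le> int m" for t
      using that by (auto simp: uv nth_append)
    then have "fst (l t) \<in> F \<and> snd (l t) < length (fst (l t)) \<and> x t = fst (l t) ! snd (l t)"
      if "\<bar>t\<bar> \<le> int m" for t
      using block_labels_nth[OF len[OF that]] that ws(1) by (auto simp: l_def in_lists_conv_set)
    moreover have "tile_step id (l t) (l (t + 1))" if "- int m \<le> t" "t < int m" for t
    proof -
      have "nat (t + 1 + int m) = Suc (nat (t + int m))" using that by simp
      then show ?thesis
        using block_labels_step[of ws "length u + nat (t + int m)"] len[of "t + 1"] that ws(1) F(2)
        by (auto simp: l_def in_lists_conv_set)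
    qed
    ultimately show ?thesis by blast
  qed
  then obtain l where l: "\<And>m t. \<bar>t\<bar> \<le> int m \<Longrightarrow> fst (l m t) \<in> F \<and>
      snd (l m t) < length (fst (l m t)) \<and> x t = fst (l m t) ! snd (l m t)"
    "\<And>m t. - int m \<le> t \<Longrightarrow> t < int m \<Longrightarrow> tile_step id (l m t) (l m (t + 1))"
    by metis
  have "l m t \<in> {q. fst q \<in> F \<and> snd q < length (id (fst q))}" if "\<bar>t\<bar> \<le> int m" for m t
    using l(1)[OF that] by simp
  then obtain g where g: "\<And>M. \<exists>m\<ge>M. \<forall>t. \<bar>t\<bar> \<le> int M \<longrightarrow> g t = l m t"
    using agreeing_limit[OF finite_tile_labels[OF F(1), of id], of l] by blast
  have "tiling F id x g"
    unfolding tiling_def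
  proof
    fix t
    \<comment> \<open>The radius exceeds \<open>\<bar>t\<bar>\<close> by one so that
      \<open>t\<close> and \<open>t + 1\<close> are both read from the same
      \<open>l m\<close>.\<close>
    obtain m where m: "nat \<bar>t\<bar> + 1 \<le> m" "\<And>s. \<bar>s\<bar> \<le> int (nat \<bar>t\<bar> + 1) \<Longrightarrow> g s = l m s"
      using g by metis
    then have "g t = l m t" "g (t + 1) = l m (t + 1)" by auto
    then show "fst (g t) \<in> F \<and> snd (g t) < length (id (fst (g t))) \<and>
        x t = id (fst (g t)) ! snd (g t) \<and> tile_step id (g t) (g (t + 1))"
      using l(1)[of t m] l(2)[of m t] m(1) by auto
  qed
  then show ?thesis by blast
qed

section \<open>The rank of a sequence of morphisms\<close>

lemma ext_word_append: "ext_word s (u @ v) = ext_word s u @ ext_word s v"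
  by (simp add: ext_word_def)

lemma ext_word_concat: "ext_word s (concat ws) = concat (map (ext_word s) ws)"
  by (induction ws) (simp_all add: ext_word_def)

lemma comp_range_same: "comp_range \<sigma> n n w = w"
  by (simp add: comp_range_def)

lemma comp_range_Suc: "n < N \<Longrightarrow> comp_range \<sigma> n N w = ext_word (\<sigma> n) (comp_range \<sigma> (Suc n) N w)"
  by (simp add: comp_range_def upt_conv_Cons)

lemma comp_range_append:
  assumes "n \<le> N"
  shows "comp_range \<sigma> n N (u @ v) = comp_range \<sigma> n N u @ comp_range \<sigma> n N v"
  using assms by (induction n rule: inc_induct) (simp_all add: comp_range_same comp_range_Suc ext_word_append)

lemma comp_range_Nil:
  assumes "n \<le> N"
  shows "comp_range \<sigma> n N [] = []"
  using assms by (induction n rule: inc_induct) (simp_all add: comp_range_same comp_range_Suc ext_word_def)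

lemma comp_range_comp:
  assumes "n \<le> N" "N \<le> N'"
  shows "comp_range \<sigma> n N' w = comp_range \<sigma> n N (comp_range \<sigma> N N' w)"
  using assms(1)
proof (induction n rule: inc_induct)
  case (step n)
  then show ?case using assms(2) by (simp add: comp_range_Suc)
qed (simp add: comp_range_same)

lemma ext_word_morphism:
  assumes "morphism A B s" "w \<in> lists A"
  shows "ext_word s w \<in> lists B" "w \<noteq> [] \<Longrightarrow> ext_word s w \<noteq> []"
  using assms by (induction w) (auto simp: ext_word_def morphism_def)

lemma comp_range_morphism:
  assumes "\<And>n. morphism (A (Suc n)) (A n) (\<sigma> n)" "n \<le> N" "w \<in> lists (A N)"
  shows "comp_range \<sigma> n N w \<in> lists (A n) \<and> (w \<noteq> [] \<longrightarrow> comp_range \<sigma> n N w \<noteq> [])"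
  using assms(2)
proof (induction n rule: inc_induct)
  case (step n)
  then show ?case using ext_word_morphism[OF assms(1)[of n]] by (simp add: comp_range_Suc)
qed (use assms(3) in \<open>simp add: comp_range_same\<close>)

definition covers :: "(nat \<Rightarrow> 'a set) \<Rightarrow> (nat \<Rightarrow> 'a \<Rightarrow> 'a list) \<Rightarrow> nat \<Rightarrow> nat \<Rightarrow> 'a list set \<Rightarrow> bool" where
  "covers A \<sigma> n N F \<longleftrightarrow> finite F \<and> [] \<notin> F \<and> F \<subseteq> lists (A n) \<and>
     (\<forall>a\<in>A N. comp_range \<sigma> n N [a] \<in> star F)"

lemma covers_comp_range_star:
  assumes "covers A \<sigma> n N F" "n \<le> N" "w \<in> lists (A N)"
  shows "comp_range \<sigma> n N w \<in> star F"
  using assms(3)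
proof (induction w)
  case Nil
  then show ?case using assms(2) by (auto simp: comp_range_Nil intro: image_eqI[of _ _ "[]"])
next
  case (Cons a w)
  then obtain us vs where "us \<in> lists F" "comp_range \<sigma> n N [a] = concat us"
    "vs \<in> lists F" "comp_range \<sigma> n N w = concat vs"
    using assms(1) unfolding covers_def by blast
  then show ?case using comp_range_append[OF assms(2), of \<sigma> "[a]" w]
    by (intro image_eqI[of _ _ "us @ vs"]) auto
qed

text \<open>Applying \<open>\<sigma> n\<close> to a product of words of \<open>F\<close> gives a
  product of words of \<open>G\<close>. Elementarity quantifies over arbitrary \<open>G\<close>; its
  words with letters outside \<open>A n\<close> cannot be factors of a word over \<open>A n\<close>
  and are dropped.\<close>

lemma covers_image:
  assumes mor: "\<And>n. morphism (A (Suc n)) (A n) (\<sigma> n)" and c: "covers A \<sigma> (Suc n) N F" and "n < N"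
    and G: "finite G" "[] \<notin> G" "ext_word (\<sigma> n) ` F \<subseteq> star G"
  shows "covers A \<sigma> n N (G \<inter> lists (A n))"
proof -
  have "comp_range \<sigma> n N [a] \<in> star (G \<inter> lists (A n))" if a: "a \<in> A N" for a
  proof -
    obtain ws where ws: "ws \<in> lists F" "comp_range \<sigma> (Suc n) N [a] = concat ws"
      using c a unfolding covers_def by blast
    then have eq: "comp_range \<sigma> n N [a] = concat (map (ext_word (\<sigma> n)) ws)"
      using \<open>n < N\<close> by (simp add: comp_range_Suc ext_word_concat)
    have "concat (map (ext_word (\<sigma> n)) ws) \<in> star (ext_word (\<sigma> n) ` F)"
      using ws(1) by (intro imageI) auto
    then have "comp_range \<sigma> n N [a] \<in> star G"
      using star_mono_trans[of "star (ext_word (\<sigma> n) ` F)", OF order.refl G(3)] unfolding eq by blast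
    then obtain gs where gs: "gs \<in> lists G" "comp_range \<sigma> n N [a] = concat gs" by blast
    have "comp_range \<sigma> n N [a] \<in> lists (A n)"
      using comp_range_morphism[of A \<sigma> n N "[a]", OF mor] \<open>n < N\<close> a by simp
    then have "gs \<in> lists (G \<inter> lists (A n))"
      using gs by (auto simp: in_lists_conv_set)
    then show ?thesis using gs(2) by auto
  qed
  then show ?thesis using G by (auto simp: covers_def)
qed

text \<open>The images of the words of \<open>F\<close> cover the level below, which makes the rank
  non-decreasing.\<close>

lemma covers_Suc:
  assumes mor: "\<And>n. morphism (A (Suc n)) (A n) (\<sigma> n)" and c: "covers A \<sigma> (Suc n) N F" and "n < N"
  shows "\<exists>G. covers A \<sigma> n N G \<and> card G \<le> card F"
proof -
  let ?G = "ext_word (\<sigma> n) ` F"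
  have F: "finite F" "[] \<notin> F" "F \<subseteq> lists (A (Suc n))" using c by (auto simp: covers_def)
  have "ext_word (\<sigma> n) f \<noteq> []" if "f \<in> F" for f
    using ext_word_morphism(2)[OF mor[of n], of f] that F by auto
  then have "[] \<notin> ?G" by (metis imageE)
  then have "covers A \<sigma> n N (?G \<inter> lists (A n))"
    using covers_image[of A \<sigma>, OF mor c \<open>n < N\<close> _ _ subset_star[OF order.refl]] F(1) by simp
  moreover have "card (?G \<inter> lists (A n)) \<le> card F"
    using F(1) by (meson card_image_le card_mono finite_imageI inf_le1 order.trans)
  ultimately show ?thesis by blast
qed

lemma sadic_shift_tiling:
  assumes fin: "\<And>n. finite (A n)" and mor: "\<And>n. morphism (A (Suc n)) (A n) (\<sigma> n)"
    and c: "covers A \<sigma> n N F" and "n \<le> N" and x: "x \<in> sadic_shift A \<sigma> n"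
  shows "\<exists>l. tiling F id x l"
proof (rule tiling_of_windows)
  show "finite F" "[] \<notin> F" using c by (auto simp: covers_def)
  fix m
  \<comment> \<open>Only finitely many words come from levels \<open>M < N\<close>. A window longer
    than all of them must come from some \<open>M \<ge> N\<close>, where the word is a product of
    words of \<open>F\<close>.\<close>
  define K where "K = (\<Union>M<N. (\<lambda>a. length (comp_range \<sigma> n M [a])) ` A M)"
  have "finite K" unfolding K_def using fin by simp
  then obtain B where B: "\<forall>k\<in>K. k \<le> B" using finite_nat_set_iff_bounded_le[of K] by blast
  define m' where "m' = m + B"
  have "map x [- int m'..int m'] \<in> language A \<sigma> n" using x by (simp add: sadic_shift_def)
  then obtain M a where M: "M > n" "a \<in> A M" "sublist (map x [- int m'..int m']) (comp_range \<sigma> n M [a])"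
    by (auto simp: language_def)
  have "\<not> M < N"
  proof
    assume "M < N"
    then have "length (comp_range \<sigma> n M [a]) \<in> K" using M(2) by (auto simp: K_def)
    then show False using B sublist_length_le[OF M(3)] by (fastforce simp: m'_def)
  qed
  then have "comp_range \<sigma> n M [a] = comp_range \<sigma> n N (comp_range \<sigma> N M [a])"
    using \<open>n \<le> N\<close> by (intro comp_range_comp) auto
  moreover have "comp_range \<sigma> N M [a] \<in> lists (A N)"
    using comp_range_morphism[of A \<sigma> N M "[a]", OF mor] M(2) \<open>\<not> M < N\<close> by simp
  ultimately have "comp_range \<sigma> n M [a] \<in> star F"
    using covers_comp_range_star[OF c \<open>n \<le> N\<close>] by simp
  moreover have "sublist (map x [- int m..int m]) (map x [- int m'..int m'])"
  proof -
    have "[- int m'..int m'] = [- int m'..- int m - 1] @ [- int m..int m] @ [int m + 1..int m']"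
      using upto_split1[of "- int m'" "- int m" "int m'"] upto_split2[of "- int m" "int m" "int m'"]
      by (simp add: m'_def)
    then show ?thesis by (auto simp: sublist_def)
  qed
  ultimately show "\<exists>w\<in>star F. sublist (map x [- int m..int m]) w"
    using M(3) sublist_order.order.trans by blast
qed

lemma frequently_small_alphabet:
  assumes "liminf (\<lambda>n. enat (card (A n))) < \<infinity>"
  obtains k where "\<And>n. \<exists>N>n. card (A N) \<le> k"
proof -
  have "\<not> \<infinity> \<le> liminf (\<lambda>n. enat (card (A n)))" using assms by simp
  then obtain y where y: "y < \<infinity>" "\<not> eventually (\<lambda>n. y < enat (card (A n))) sequentially"
    unfolding le_Liminf_iff by blast
  then obtain k where k: "y = enat k" by (cases y) auto
  have "\<exists>N>n. card (A N) \<le> k" for n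
    using y(2) unfolding k eventually_sequentially by (metis Suc_le_eq enat_ord_simps(2) not_less)
  then show thesis using that by blast
qed

theorem theorem5p2:
  fixes A :: "nat \<Rightarrow> 'a set" and \<sigma> :: "nat \<Rightarrow> 'a \<Rightarrow> 'a list"
  assumes "\<And>n. finite (A n)"
    and "\<And>n. morphism (A (Suc n)) (A n) (\<sigma> n)"
    and "everywhere_growing A \<sigma>"
    and "liminf (\<lambda>n. enat (card (A n))) < \<infinity>"
  shows "\<exists>n\<^sub>0. \<forall>n\<ge>n\<^sub>0.
    recognizable_for_aperiodic (A (Suc n)) (A n) (\<sigma> n) (sadic_shift A \<sigma> (Suc n))"
proof -
  note mor = assms(2)
  define is_rank where "is_rank n k \<longleftrightarrow> (\<exists>N>n. \<exists>F. covers A \<sigma> n N F \<and> card F = k)" for n k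
  define rank where "rank n = (LEAST k. is_rank n k)" for n
  obtain k where k: "\<And>n. \<exists>N>n. card (A N) \<le> k" using frequently_small_alphabet[OF assms(4)] by blast
  have bounded: "\<exists>j\<le>k. is_rank n j" for n
  proof -
    obtain N where N: "n < N" "card (A N) \<le> k" using k by blast
    \<comment> \<open>The images of the letters of a level with at most \<open>k\<close> letters
      cover level \<open>n\<close>.\<close>
    define F where "F = (\<lambda>a. comp_range \<sigma> n N [a]) ` A N"
    have "f \<in> lists (A n) \<and> f \<noteq> []" if f: "f \<in> F" for f
    proof -
      obtain a where "a \<in> A N" "f = comp_range \<sigma> n N [a]" using f by (auto simp: F_def)
      then show ?thesis using comp_range_morphism[of A \<sigma> n N "[a]", OF mor] N(1) by simp
    qed
    then have "covers A \<sigma> n N F"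
      using assms(1)[of N] subset_star[of F F] by (fastforce simp: covers_def F_def)
    moreover have "card F \<le> k" using N(2) card_image_le[OF assms(1)[of N]] by (auto simp: F_def intro: order.trans)
    ultimately show ?thesis using N(1) by (auto simp: is_rank_def)
  qed
  have rank: "is_rank n (rank n)" for n
    unfolding rank_def using bounded[of n] LeastI by metis
  have rank_le: "rank n \<le> j" if "is_rank n j" for n j
    unfolding rank_def using that by (rule Least_le)
  have rank_bounded: "rank n \<le> k" for n using bounded[of n] rank_le order.trans by blast
  have rank_mono: "rank n \<le> rank (Suc n)" for n
  proof -
    obtain N F where "Suc n < N" "covers A \<sigma> (Suc n) N F" "card F = rank (Suc n)"
      using rank[of "Suc n"] unfolding is_rank_def by blast
    moreover then obtain G where "covers A \<sigma> n N G" "card G \<le> card F"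
      using covers_Suc[of A \<sigma> n N F, OF mor] by auto
    ultimately have "rank n \<le> card G" by (intro rank_le) (auto simp: is_rank_def intro!: exI[of _ N])
    then show ?thesis using \<open>card G \<le> card F\<close> \<open>card F = rank (Suc n)\<close> by simp
  qed
  have "finite (range rank)" using rank_bounded by (auto intro: finite_subset[of _ "{..k}"])
  \<comment> \<open>Being non-decreasing, the rank is constant from any level on where it attains
    its maximum.\<close>
  then have "Max (range rank) \<in> range rank" by (intro Max_in) auto
  then obtain n0 where n0: "rank n0 = Max (range rank)" by (metis imageE)
  have const: "rank n = rank n0" if "n \<ge> n0" for n
  proof (rule antisym)
    show "rank n \<le> rank n0" unfolding n0 using \<open>finite (range rank)\<close> by (intro Max_ge) auto
    show "rank n0 \<le> rank n" using rank_mono that by (rule lift_Suc_mono_le)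
  qed
  have "recognizable_for_aperiodic (A (Suc n)) (A n) (\<sigma> n) (sadic_shift A \<sigma> (Suc n))"
    if "n \<ge> n0" for n
  proof -
    obtain N F where N: "Suc n < N" and c: "covers A \<sigma> (Suc n) N F" and F: "card F = rank (Suc n)"
      using rank[of "Suc n"] unfolding is_rank_def by blast
    have "elementary F (ext_word (\<sigma> n))"
      unfolding elementary_def
    proof (intro conjI allI impI ballI)
      show "finite F" using c by (simp add: covers_def)
      show "ext_word (\<sigma> n) f \<noteq> []" if "f \<in> F" for f
        using that c ext_word_morphism(2)[OF mor[of n], of f] by (auto simp: covers_def)
      \<comment> \<open>Such a \<open>G\<close> covers level \<open>n\<close>, so having fewer words
        than \<open>F\<close> would make the rank of \<open>n\<close> smaller than that of
        \<open>Suc n\<close>.\<close>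
      fix G assume G: "finite G" "[] \<notin> G" "ext_word (\<sigma> n) ` F \<subseteq> star G"
      then have "covers A \<sigma> n N (G \<inter> lists (A n))" using covers_image[of A \<sigma>, OF mor c _ G] N by simp
      then have "rank n \<le> card (G \<inter> lists (A n))"
        using N by (intro rank_le) (auto simp: is_rank_def intro!: exI[of _ N])
      moreover have "card (G \<inter> lists (A n)) \<le> card G" using G(1) by (intro card_mono) auto
      moreover have "rank n = rank (Suc n)" using const[of n] const[of "Suc n"] that by simp
      ultimately show "card F \<le> card G" using F by simp
    qed
    then show ?thesis
      using sadic_shift_tiling[of A \<sigma>, OF assms(1) mor c] N
      by (intro recognizable_of_elementary[OF mor]) auto
  qed
  then show ?thesis by blast
qed

end
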